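(* Let the network $(I,E)$ be a chain network (a directed path), with user groups, latencies and constraint function $h$ as in the context, and let $\boldsymbol\lambda=(\lambda_E,\lambda_R,\lambda_I)\in\mathbb{R}_{\ge 0}^3$. Suppose that: (1) $h$ is continuous and the set $\{(y,\tau)\in\mathcal{Y}_{\mathrm{adm}}\times\mathbb{R}^{|E|T}: h(y,\tau)\le 0\}$ is bounded; (2) for every $\tau\in\mathbb{R}_{\ge0}^{|E|T}$ and all $y,\bar y\in\mathcal{Y}_{\mathrm{adm}}$ such that, for all $e\in E,k\in[2],t\in[T]$, $\sum_{g\in G_e^E}y_{e,k,t}^g=\sum_{g\in G_e^E}\bar y_{e,k,t}^g$ and $y_{e,k,t}^{g'}=\bar y_{e,k,t}^{g'}$ for all $g'\in G_e^I$, one has $h(y,\tau)=h(\bar y,\tau)$; (3) for every $\tau\in\mathbb{R}_{\ge0}^{|E|T}$ and every $(\tau,\mathbf 0)$-DBCP equilibrium $y^\star$, for each $e\in E$, $t\in[T]$ with $\tau_{e,t}>0$, one has $y_{e,1,t}^{g\star}=0$ for each $g\in G_e^E$; (4) there exist $(y^\star,x^\star,\tau^\star,B^\star)\in S_{C,\boldsymbol\lambda}^\star$, $e\in E$, $t\in[T]$ and $g\in G_e^E$ such that $(y^\star)_{e,1,t}^g>0$ and $x_{e,1,t}^\star<x_{e,2,t}^\star$. If $\lambda_R>\lambda_E$ and $S_{C,\boldsymbol\lambda}\neq\emptyset$, $S_{D,\boldsymbol\lambda}\ne\emptyset$, then $f_{D,\boldsymbol\lambda}^\star<f_{C,\bo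ldsymbol\lambda}^\star$.
   Context: Network. $(I,E)$ is a chain network: a finite directed path, i.e. distinct nodes $i_0,\dots,i_m$ and edges $e_l$ from $i_{l-1}$ to $i_l$, $l=1,\dots,m$. $E_i^{\mathrm{in}},E_i^{\mathrm{out}}$ are the edges entering/leaving node $i$. Each edge has two lanes $k\in[2]=\{1,2\}$: an express lane ($k=1$, may be tolled) and a toll-free general-purpose lane ($k=2$). Both lanes of $e$ have the same latency function $\ell_e:\mathbb{R}\to\mathbb{R}$, strictly increasing, convex, nonnegative on $\mathbb{R}_{\ge0}$. Periods are $t\in[T]=\{1,\dots,T\}$. Users. $G=G^E\sqcup G^I$ is a finite set of groups, eligible ($G^E$) or ineligible ($G^I$). Group $g$ has an origin $p_o^g$ and destination $p_d^g$ joined by at least one directed route, a demand $d^g\ge0$, and values of time (VoT) $v_t^g>0$, $t\in[T]$. $G_e$ is the set of groups having a route from $p_o^g$ to $p_d^g$ containing $e$; $G_e^E=G_e\cap G^E$, $G_e^I=G_e\cap G^I$; $n=\sum_{e}|G_e|$. Flows. A flow is $y=(y_{e,k,t}^g: e\in E,k\in[2],t\in[T],g\in G_e)\in\mathbb{R}_{\ge0}^{2nT}$; $\mathcal{Y}_{\mathrm{adm}}$ is the set of flows such that for all $i\in I,g\in G,t\in[T]$: $d^g\mathbf 1\{i=p_o^g\}+\sum_{e\in E_i^{\mathrm{in}}}\sum_{k}y_{e,k,t}^g=d^g\mathbf 1\{i=p_d^g\}+\sum_{e\in E_i^{\mathrm{out}}}\sum_{k}y_{e,k,t}^g$ (sums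 over edges with $g\in G_e$). Lane flows: $x_{e,k,t}=\sum_{g\in G_e}y_{e,k,t}^g$. DBCP (discount-based congestion pricing). A policy is $(\tau,\alpha)$ with tolls $\tau\in\mathbb{R}_{\ge0}^{|E|T}$ and discounts $\alpha\in[0,1]^{|E|T}$. The feasible set is $\mathcal{Y}_{\mathrm{adm}}$. The cost $c_{e,k,t}^g(y)$ is $v_t^g\ell_e(x_{e,1,t})+\tau_{e,t}$ if $k=1,g\in G^I$; $v_t^g\ell_e(x_{e,1,t})+(1-\alpha_{e,t})\tau_{e,t}$ if $k=1,g\in G^E$; $v_t^g\ell_e(x_{e,2,t})$ if $k=2$. CBCP (credit-based congestion pricing). A policy is $(\tau,B)$ with $\tau\in\mathbb{R}_{\ge0}^{|E|T}$ and budgets $B\in\mathbb{R}_{\ge0}^{|G^E|}$. The feasible set is $\{y\in\mathcal{Y}_{\mathrm{adm}}:\sum_{t}\sum_{e}y_{e,1,t}^g\tau_{e,t}\le B^g\ \forall g\in G^E\}$. The cost $c_{e,k,t}^g(y)$ is $v_t^g\ell_e(x_{e,1,t})+\tau_{e,t}$ if $k=1,g\in G^I$, and $v_t^g\ell_e(x_{e,k,t})$ otherwise. Equilibrium. For either kind of policy, $y^\star$ is an equilibrium if it is feasible and for each $g\in G$ and every feasible $y$: $\sum_{e,k,t}(y_{e,k,t}^g-y_{e,k,t}^{g\star})c_{e,k,t}^g(y^\star)\ge0$. Societal costs. $h:\mathcal{Y}_{\mathrm{adm}}\times\mathbb{R}^{|E|T}\to\mathbb{R}^{n_c}$ is a given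 constraint function (inequalities $h\le0$ are componentwise). $f_{C,\boldsymbol\lambda}(y,x,\tau)=\lambda_E\sum_{t,e,k}\sum_{g\in G_e^E}v_t^g\ell_e(x_{e,k,t})y_{e,k,t}^g-\lambda_R\sum_{t,e}\sum_{g\in G_e^I}\tau_{e,t}y_{e,1,t}^g+\lambda_I\sum_{t,e,k}\sum_{g\in G_e^I}(v_t^g\ell_e(x_{e,k,t})+\mathbf 1\{k=1\}\tau_{e,t})y_{e,k,t}^g$. $f_{D,\boldsymbol\lambda}(y,x,\tau,\alpha)=\lambda_E\sum_{t,e,k}\sum_{g\in G_e^E}(v_t^g\ell_e(x_{e,k,t})+\mathbf 1\{k=1\}(1-\alpha_{e,t})\tau_{e,t})y_{e,k,t}^g+\lambda_I\sum_{t,e,k}\sum_{g\in G_e^I}(v_t^g\ell_e(x_{e,k,t})+\mathbf 1\{k=1\}\tau_{e,t})y_{e,k,t}^g-\lambda_R\sum_{t,e}\big(\sum_{g\in G_e^E}(1-\alpha_{e,t})\tau_{e,t}y_{e,1,t}^g+\sum_{g\in G_e^I}\tau_{e,t}y_{e,1,t}^g\big)$. $S_{C,\boldsymbol\lambda}$ is the set of $(y,x,\tau,B)$ with $\tau\in\mathbb{R}_{\ge0}^{|E|T}$, $B\in\mathbb{R}_{\ge0}^{|G^E|}$, $y$ a $(\tau,B)$-CBCP equilibrium with lane flows $x$, and $h(y,\tau)\le0$; $f_{C,\boldsymbol\lambda}^\star$ is the infimum of $f_{C,\boldsymbol\lambda}(y,x,\tau)$ over $S_{C,\boldsymbol\lambda}$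 and $S_{C,\boldsymbol\lambda}^\star\subseteq S_{C,\boldsymbol\lambda}$ is its set of minimizers. $S_{D,\boldsymbol\lambda}$ is the set of $(y,x,\tau,\alpha)$ with $\tau\in\mathbb{R}_{\ge0}^{|E|T}$, $\alpha\in[0,1]^{|E|T}$, $y$ a $(\tau,\alpha)$-DBCP equilibrium with lane flows $x$, and $h(y,\tau)\le0$; $f_{D,\boldsymbol\lambda}^\star$ is the infimum of $f_{D,\boldsymbol\lambda}(y,x,\tau,\alpha)$ over $S_{D,\boldsymbol\lambda}$. *)

theory Defs
  imports "HOL-Analysis.Analysis" "Graph_Theory.Arc_Walk"
begin

text \<open>
  Edges, periods and groups are the elements of finite types \<open>'e\<close>, \<open>'t\<close>, \<open>'g\<close>, so that flows,
  tolls, discounts and budgets live in Euclidean spaces, where continuity and boundedness are the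
  library's. The network is a digraph over \<open>'e\<close> in the sense of the Graph Theory entry.
\<close>

datatype lane = Express | General

instance lane :: finite
proof
  have "(UNIV :: lane set) = {Express, General}"
    using lane.exhaust by blast
  then show "finite (UNIV :: lane set)"
    by (metis finite.emptyI finite.insertI)
qed

record ('v, 'e, 't, 'g) tolled_network =
  graph :: "('v, 'e) pre_digraph"
  latency :: "'e \<Rightarrow> real \<Rightarrow> real"
  eligible :: "'g set"
  origin :: "'g \<Rightarrow> 'v"
  dest :: "'g \<Rightarrow> 'v"
  demand :: "'g \<Rightarrow> real"
  vot :: "'g \<Rightarrow> 't \<Rightarrow> real"

definition directed_path_graph :: "('v, 'e) pre_digraph \<Rightarrow> bool" where
  "directed_path_graph N \<longleftrightarrow>
     (\<exists>ns es. distinct ns \<and> length ns = Suc (length es) \<and>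
        verts N = set ns \<and> arcs N = set es \<and>
        (\<forall>l < length es. tail N (es ! l) = ns ! l \<and> head N (es ! l) = ns ! Suc l))"

definition routes :: "('v, 'e, 't, 'g) tolled_network \<Rightarrow> 'g \<Rightarrow> 'e list set" where
  "routes M g = {p. pre_digraph.apath (graph M) (origin M g) p (dest M g)}"

text \<open>
  \<open>arcs (graph M) = UNIV\<close> says that \<open>'e\<close> consists of exactly the edges of the network.
\<close>

definition chain_instance :: "('v, 'e::finite, 't::finite, 'g::finite) tolled_network \<Rightarrow> bool" where
  "chain_instance M \<longleftrightarrow>
     directed_path_graph (graph M) \<and> arcs (graph M) = UNIV \<and>
     (\<forall>e. strict_mono_on {0..} (latency M e) \<and> convex_on {0..} (latency M e) \<and>
          (\<forall>z\<ge>0. 0 \<le> latency M e z)) \<and>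
     (\<forall>g. routes M g \<noteq> {} \<and> 0 \<le> demand M g \<and> (\<forall>t. 0 < vot M g t))"

text \<open>This is \<open>G\<^sub>e\<close>; on a chain each group has exactly one route.\<close>

definition groups_on :: "('v, 'e, 't, 'g) tolled_network \<Rightarrow> 'e \<Rightarrow> 'g set" where
  "groups_on M e = {g. \<exists>p \<in> routes M g. e \<in> set p}"

definition elig_on :: "('v, 'e, 't, 'g) tolled_network \<Rightarrow> 'e \<Rightarrow> 'g set" where
  "elig_on M e = groups_on M e \<inter> eligible M"

definition inelig_on :: "('v, 'e, 't, 'g) tolled_network \<Rightarrow> 'e \<Rightarrow> 'g set" where
  "inelig_on M e = groups_on M e - eligible M"

text \<open>
  A flow is a family indexed by those \<open>(e, k, t, g)\<close> with \<open>g \<in> G\<^sub>e\<close>; it is represented by the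
  vector \<open>y\<close> with entries \<open>y $ e $ k $ t $ g\<close> that vanishes at all other indices.
\<close>

type_synonym ('e, 't, 'g) flow = "real ^ 'g ^ 't ^ lane ^ 'e"
type_synonym ('e, 't) lane_flows = "real ^ 't ^ lane ^ 'e"
type_synonym ('e, 't) edge_vec = "real ^ 't ^ 'e"

definition flows ::
  "('v, 'e::finite, 't::finite, 'g::finite) tolled_network \<Rightarrow> ('e, 't, 'g) flow set" where
  "flows M = {y. \<forall>e k t g. 0 \<le> y $ e $ k $ t $ g \<and>
                   (g \<notin> groups_on M e \<longrightarrow> y $ e $ k $ t $ g = 0)}"

definition admissible ::
  "('v, 'e::finite, 't::finite, 'g::finite) tolled_network \<Rightarrow> ('e, 't, 'g) flow set" where
  "admissible M = {y \<in> flows M. \<forall>i \<in> verts (graph M). \<forall>g t.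
     demand M g * of_bool (i = origin M g)
       + (\<Sum>e | e \<in> in_arcs (graph M) i \<and> g \<in> groups_on M e. \<Sum>k\<in>UNIV. y $ e $ k $ t $ g)
     = demand M g * of_bool (i = dest M g)
       + (\<Sum>e | e \<in> out_arcs (graph M) i \<and> g \<in> groups_on M e. \<Sum>k\<in>UNIV. y $ e $ k $ t $ g)}"

definition lane_flow ::
  "('v, 'e::finite, 't::finite, 'g::finite) tolled_network \<Rightarrow> ('e, 't, 'g) flow
     \<Rightarrow> ('e, 't) lane_flows" where
  "lane_flow M y = (\<chi> e k t. \<Sum>g\<in>groups_on M e. y $ e $ k $ t $ g)"

definition tolls :: "('e::finite, 't::finite) edge_vec set" where
  "tolls = {\<tau>. \<forall>e t. 0 \<le> \<tau> $ e $ t}"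

definition discounts :: "('e::finite, 't::finite) edge_vec set" where
  "discounts = {\<alpha>. \<forall>e t. 0 \<le> \<alpha> $ e $ t \<and> \<alpha> $ e $ t \<le> 1}"

text \<open>Budgets are indexed by the eligible groups only, hence zero at the other indices.\<close>

definition budgets :: "('v, 'e, 't, 'g::finite) tolled_network \<Rightarrow> (real ^ 'g) set" where
  "budgets M = {B. \<forall>g. 0 \<le> B $ g \<and> (g \<notin> eligible M \<longrightarrow> B $ g = 0)}"

definition equilibrium ::
  "('v, 'e::finite, 't::finite, 'g::finite) tolled_network
     \<Rightarrow> (('e, 't, 'g) flow \<Rightarrow> 'e \<Rightarrow> lane \<Rightarrow> 't \<Rightarrow> 'g \<Rightarrow> real)
     \<Rightarrow> ('e, 't, 'g) flow set \<Rightarrow> ('e, 't, 'g) flow \<Rightarrow> bool" where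
  "equilibrium M c F ys \<longleftrightarrow>
     ys \<in> F \<and>
     (\<forall>g. \<forall>y\<in>F.
        0 \<le> (\<Sum>e | g \<in> groups_on M e. \<Sum>k\<in>UNIV. \<Sum>t\<in>UNIV.
               (y $ e $ k $ t $ g - ys $ e $ k $ t $ g) * c ys e k t g))"

definition dbcp_cost ::
  "('v, 'e::finite, 't::finite, 'g::finite) tolled_network
     \<Rightarrow> ('e, 't) edge_vec \<Rightarrow> ('e, 't) edge_vec
     \<Rightarrow> ('e, 't, 'g) flow \<Rightarrow> 'e \<Rightarrow> lane \<Rightarrow> 't \<Rightarrow> 'g \<Rightarrow> real" where
  "dbcp_cost M \<tau> \<alpha> y e k t g =
     vot M g t * latency M e (lane_flow M y $ e $ k $ t) +
     (case k of
        Express \<Rightarrow> if g \<in> eligible M then (1 - \<alpha> $ e $ t) * \<tau> $ e $ t else \<tau> $ e $ t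
      | General \<Rightarrow> 0)"

definition dbcp_equilibrium ::
  "('v, 'e::finite, 't::finite, 'g::finite) tolled_network
     \<Rightarrow> ('e, 't) edge_vec \<Rightarrow> ('e, 't) edge_vec \<Rightarrow> ('e, 't, 'g) flow \<Rightarrow> bool" where
  "dbcp_equilibrium M \<tau> \<alpha> = equilibrium M (dbcp_cost M \<tau> \<alpha>) (admissible M)"

definition cbcp_cost ::
  "('v, 'e::finite, 't::finite, 'g::finite) tolled_network
     \<Rightarrow> ('e, 't) edge_vec
     \<Rightarrow> ('e, 't, 'g) flow \<Rightarrow> 'e \<Rightarrow> lane \<Rightarrow> 't \<Rightarrow> 'g \<Rightarrow> real" where
  "cbcp_cost M \<tau> y e k t g =
     vot M g t * latency M e (lane_flow M y $ e $ k $ t) +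
     (if k = Express \<and> g \<notin> eligible M then \<tau> $ e $ t else 0)"

definition cbcp_feasible ::
  "('v, 'e::finite, 't::finite, 'g::finite) tolled_network
     \<Rightarrow> ('e, 't) edge_vec \<Rightarrow> real ^ 'g \<Rightarrow> ('e, 't, 'g) flow set" where
  "cbcp_feasible M \<tau> B =
     {y \<in> admissible M. \<forall>g \<in> eligible M.
        (\<Sum>t\<in>UNIV. \<Sum>e | g \<in> groups_on M e. y $ e $ Express $ t $ g * \<tau> $ e $ t) \<le> B $ g}"

definition cbcp_equilibrium ::
  "('v, 'e::finite, 't::finite, 'g::finite) tolled_network
     \<Rightarrow> ('e, 't) edge_vec \<Rightarrow> real ^ 'g \<Rightarrow> ('e, 't, 'g) flow \<Rightarrow> bool" where
  "cbcp_equilibrium M \<tau> B = equilibrium M (cbcp_cost M \<tau>) (cbcp_feasible M \<tau> B)"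

text \<open>\<open>lE\<close>, \<open>lR\<close>, \<open>lI\<close> are the weights \<open>\<lambda>\<^sub>E\<close>, \<open>\<lambda>\<^sub>R\<close>, \<open>\<lambda>\<^sub>I\<close>.\<close>

definition cbcp_objective ::
  "('v, 'e::finite, 't::finite, 'g::finite) tolled_network \<Rightarrow> real \<Rightarrow> real \<Rightarrow> real
     \<Rightarrow> ('e, 't, 'g) flow \<Rightarrow> ('e, 't) lane_flows \<Rightarrow> ('e, 't) edge_vec \<Rightarrow> real" where
  "cbcp_objective M lE lR lI y x \<tau> =
     lE * (\<Sum>t\<in>UNIV. \<Sum>e\<in>UNIV. \<Sum>k\<in>UNIV. \<Sum>g\<in>elig_on M e.
             vot M g t * latency M e (x $ e $ k $ t) * y $ e $ k $ t $ g)
   - lR * (\<Sum>t\<in>UNIV. \<Sum>e\<in>UNIV. \<Sum>g\<in>inelig_on M e. \<tau> $ e $ t * y $ e $ Express $ t $ g)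
   + lI * (\<Sum>t\<in>UNIV. \<Sum>e\<in>UNIV. \<Sum>k\<in>UNIV. \<Sum>g\<in>inelig_on M e.
             (vot M g t * latency M e (x $ e $ k $ t) + of_bool (k = Express) * \<tau> $ e $ t)
               * y $ e $ k $ t $ g)"

definition dbcp_objective ::
  "('v, 'e::finite, 't::finite, 'g::finite) tolled_network \<Rightarrow> real \<Rightarrow> real \<Rightarrow> real
     \<Rightarrow> ('e, 't, 'g) flow \<Rightarrow> ('e, 't) lane_flows \<Rightarrow> ('e, 't) edge_vec
     \<Rightarrow> ('e, 't) edge_vec \<Rightarrow> real" where
  "dbcp_objective M lE lR lI y x \<tau> \<alpha> =
     lE * (\<Sum>t\<in>UNIV. \<Sum>e\<in>UNIV. \<Sum>k\<in>UNIV. \<Sum>g\<in>elig_on M e.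
             (vot M g t * latency M e (x $ e $ k $ t)
                + of_bool (k = Express) * (1 - \<alpha> $ e $ t) * \<tau> $ e $ t) * y $ e $ k $ t $ g)
   + lI * (\<Sum>t\<in>UNIV. \<Sum>e\<in>UNIV. \<Sum>k\<in>UNIV. \<Sum>g\<in>inelig_on M e.
             (vot M g t * latency M e (x $ e $ k $ t) + of_bool (k = Express) * \<tau> $ e $ t)
               * y $ e $ k $ t $ g)
   - lR * (\<Sum>t\<in>UNIV. \<Sum>e\<in>UNIV.
             (\<Sum>g\<in>elig_on M e. (1 - \<alpha> $ e $ t) * \<tau> $ e $ t * y $ e $ Express $ t $ g)
           + (\<Sum>g\<in>inelig_on M e. \<tau> $ e $ t * y $ e $ Express $ t $ g))"

text \<open>
  The constraint function \<open>h\<close> is only ever evaluated on \<open>admissible M \<times> UNIV\<close>; the order on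
  \<open>real ^ 'n\<close> in \<open>h (y, \<tau>) \<le> 0\<close> is componentwise.
\<close>

definition cbcp_set ::
  "('v, 'e::finite, 't::finite, 'g::finite) tolled_network
     \<Rightarrow> (('e, 't, 'g) flow \<times> ('e, 't) edge_vec \<Rightarrow> real ^ 'n)
     \<Rightarrow> (('e, 't, 'g) flow \<times> ('e, 't) lane_flows \<times> ('e, 't) edge_vec \<times> (real ^ 'g)) set" where
  "cbcp_set M h = {(y, x, \<tau>, B).
     \<tau> \<in> tolls \<and> B \<in> budgets M \<and> cbcp_equilibrium M \<tau> B y \<and> x = lane_flow M y \<and> h (y, \<tau>) \<le> 0}"

definition dbcp_set ::
  "('v, 'e::finite, 't::finite, 'g::finite) tolled_network
     \<Rightarrow> (('e, 't, 'g) flow \<times> ('e, 't) edge_vec \<Rightarrow> real ^ 'n)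
     \<Rightarrow> (('e, 't, 'g) flow \<times> ('e, 't) lane_flows \<times> ('e, 't) edge_vec \<times> ('e, 't) edge_vec) set"
  where
  "dbcp_set M h = {(y, x, \<tau>, \<alpha>).
     \<tau> \<in> tolls \<and> \<alpha> \<in> discounts \<and> dbcp_equilibrium M \<tau> \<alpha> y \<and> x = lane_flow M y \<and> h (y, \<tau>) \<le> 0}"

text \<open>The infima are taken in the extended reals, so no boundedness is presupposed.\<close>

definition cbcp_inf ::
  "('v, 'e::finite, 't::finite, 'g::finite) tolled_network
     \<Rightarrow> (('e, 't, 'g) flow \<times> ('e, 't) edge_vec \<Rightarrow> real ^ 'n)
     \<Rightarrow> real \<Rightarrow> real \<Rightarrow> real \<Rightarrow> ereal" where
  "cbcp_inf M h lE lR lI =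
     (INF (y, x, \<tau>, B) \<in> cbcp_set M h. ereal (cbcp_objective M lE lR lI y x \<tau>))"

definition dbcp_inf ::
  "('v, 'e::finite, 't::finite, 'g::finite) tolled_network
     \<Rightarrow> (('e, 't, 'g) flow \<times> ('e, 't) edge_vec \<Rightarrow> real ^ 'n)
     \<Rightarrow> real \<Rightarrow> real \<Rightarrow> real \<Rightarrow> ereal" where
  "dbcp_inf M h lE lR lI =
     (INF (y, x, \<tau>, \<alpha>) \<in> dbcp_set M h. ereal (dbcp_objective M lE lR lI y x \<tau> \<alpha>))"

definition cbcp_minimizers ::
  "('v, 'e::finite, 't::finite, 'g::finite) tolled_network
     \<Rightarrow> (('e, 't, 'g) flow \<times> ('e, 't) edge_vec \<Rightarrow> real ^ 'n)
     \<Rightarrow> real \<Rightarrow> real \<Rightarrow> real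
     \<Rightarrow> (('e, 't, 'g) flow \<times> ('e, 't) lane_flows \<times> ('e, 't) edge_vec \<times> (real ^ 'g)) set" where
  "cbcp_minimizers M h lE lR lI = {(y, x, \<tau>, B) \<in> cbcp_set M h.
     ereal (cbcp_objective M lE lR lI y x \<tau>) = cbcp_inf M h lE lR lI}"

end

theory Submission
  imports Defs
begin

text \<open>
  On a path the flow of each group on each edge is determined by conservation, so users only choose
  lanes, separately for every edge and period. Take a CBCP minimizer and keep its tolls, its
  ineligible flows and, on each lane, the total eligible flow; only reassign the eligible groups,
  giving the express lane to those with the highest values of time. The price at which this
  assignment is an equilibrium is the value of the latency gap to the marginal group. It does not
  exceed the toll: otherwise some eligible group would value the gap above the toll, and the
  ineligible groups ahead of all eligible ones would occupy less than half of the edge; some toll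
  would then draw eligible users onto the express lane without any discount. Hence a suitable
  discount realizes the price. Reassignment does not increase the eligible travel cost, and the
  collected revenue changes the objective by \<open>\<lambda>\<^sub>E - \<lambda>\<^sub>R < 0\<close> per unit. The revenue is positive on an
  edge where eligible users enjoy a strictly faster express lane.
\<close>

section \<open>Reassigning groups between the two lanes of an edge\<close>

lemma sum_lane: "(\<Sum>k\<in>UNIV. f k) = f Express + f General"
proof -
  have U: "(UNIV :: lane set) = {Express, General}"
    using lane.exhaust by blast
  show ?thesis unfolding U by simp
qed

definition edge_flow :: "('e::finite, 't::finite, 'g::finite) flow \<Rightarrow> 'e \<Rightarrow> 't \<Rightarrow> 'g \<Rightarrow> real" where
  "edge_flow y e t g = y $ e $ Express $ t $ g + y $ e $ General $ t $ g"

text \<open>\<open>z\<close> prescribes the express flows and the general lane receives the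
  remainder, so every group keeps its edge flow; the value 0 off \<open>groups_on\<close> keeps the
  result in \<open>flows\<close>.\<close>

definition relane ::
  "('v, 'e::finite, 't::finite, 'g::finite) tolled_network \<Rightarrow> ('e, 't, 'g) flow
     \<Rightarrow> ('e \<Rightarrow> 't \<Rightarrow> 'g \<Rightarrow> real) \<Rightarrow> ('e, 't, 'g) flow" where
  "relane M y z = (\<chi> e k t g. if g \<in> groups_on M e
     then (case k of Express \<Rightarrow> z e t g | General \<Rightarrow> edge_flow y e t g - z e t g) else 0)"

lemma relane_nth [simp]:
  "g \<in> groups_on M e \<Longrightarrow> relane M y z $ e $ Express $ t $ g = z e t g"
  "g \<in> groups_on M e \<Longrightarrow> relane M y z $ e $ General $ t $ g = edge_flow y e t g - z e t g"
  "g \<notin> groups_on M e \<Longrightarrow> relane M y z $ e $ k $ t $ g = 0"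
  by (simp_all add: relane_def)

lemma flows_nonneg: "y \<in> flows M \<Longrightarrow> 0 \<le> y $ e $ k $ t $ g"
  by (simp add: flows_def)

lemma flows_zero: "y \<in> flows M \<Longrightarrow> g \<notin> groups_on M e \<Longrightarrow> y $ e $ k $ t $ g = 0"
  by (simp add: flows_def)

lemma admissible_flows: "y \<in> admissible M \<Longrightarrow> y \<in> flows M"
  by (simp add: admissible_def)

text \<open>Conservation involves only the sum over both lanes, which relaning preserves.\<close>

lemma relane_admissible:
  assumes y: "y \<in> admissible M"
    and z: "\<And>e t g. g \<in> groups_on M e \<Longrightarrow> 0 \<le> z e t g \<and> z e t g \<le> edge_flow y e t g"
  shows "relane M y z \<in> admissible M"
proof -
  have "0 \<le> relane M y z $ e $ k $ t $ g" for e k t g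
    using z by (cases "g \<in> groups_on M e"; cases k) simp_all
  then have "relane M y z \<in> flows M"
    by (simp add: flows_def)
  moreover have "(\<Sum>e | e \<in> A \<and> g \<in> groups_on M e. \<Sum>k\<in>UNIV. relane M y z $ e $ k $ t $ g)
      = (\<Sum>e | e \<in> A \<and> g \<in> groups_on M e. \<Sum>k\<in>UNIV. y $ e $ k $ t $ g)" for A g t
    by (rule sum.cong) (simp_all add: sum_lane edge_flow_def)
  ultimately show ?thesis
    using y by (simp add: admissible_def del: in_in_arcs_conv in_out_arcs_conv)
qed

section \<open>Uniqueness of the edge flows on a path\<close>

lemma admissible_conservation:
  assumes "y \<in> admissible M" "i \<in> verts (graph M)"
  shows "demand M g * of_bool (i = origin M g) + (\<Sum>e\<in>in_arcs (graph M) i. edge_flow y e t g)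
       = demand M g * of_bool (i = dest M g) + (\<Sum>e\<in>out_arcs (graph M) i. edge_flow y e t g)"
proof -
  have "(\<Sum>e | e \<in> A \<and> g \<in> groups_on M e. \<Sum>k\<in>UNIV. y $ e $ k $ t $ g)
      = (\<Sum>e\<in>A. edge_flow y e t g)" for A
    using flows_zero[OF admissible_flows[OF assms(1)]]
    by (intro sum.mono_neutral_cong_left) (auto simp: sum_lane edge_flow_def)
  moreover have "demand M g * of_bool (i = origin M g)
       + (\<Sum>e | e \<in> in_arcs (graph M) i \<and> g \<in> groups_on M e. \<Sum>k\<in>UNIV. y $ e $ k $ t $ g)
     = demand M g * of_bool (i = dest M g)
       + (\<Sum>e | e \<in> out_arcs (graph M) i \<and> g \<in> groups_on M e. \<Sum>k\<in>UNIV. y $ e $ k $ t $ g)"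
    using assms unfolding admissible_def mem_Collect_eq by blast
  ultimately show ?thesis by (simp only:)
qed

text \<open>Conservation, applied node by node from the start of the path, determines the edge flows.\<close>

lemma edge_flow_unique:
  assumes path: "directed_path_graph (graph M)" and arcs: "arcs (graph M) = UNIV"
    and y: "y \<in> admissible M" and y': "y' \<in> admissible M"
  shows "edge_flow y e t g = edge_flow y' e t g"
proof -
  obtain ns es where ns: "distinct ns" "length ns = Suc (length es)" "verts (graph M) = set ns"
    and es: "set es = UNIV"
    and th: "\<And>l. l < length es \<Longrightarrow> tail (graph M) (es ! l) = ns ! l"
      "\<And>l. l < length es \<Longrightarrow> head (graph M) (es ! l) = ns ! Suc l"
    using path arcs unfolding directed_path_graph_def by auto
  have idx: "\<exists>j < length es. a = es ! j" for a
    using es by (metis UNIV_I in_set_conv_nth)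
  \<comment> \<open>Since the nodes are distinct, each conservation equation involves at most one
    incoming and one outgoing edge.\<close>
  have out: "out_arcs (graph M) (ns ! l) = {es ! l}" if "l < length es" for l
  proof -
    have "a = es ! l" if "tail (graph M) a = ns ! l" for a
    proof -
      obtain j where j: "j < length es" "a = es ! j" using idx by blast
      then have "ns ! j = ns ! l" using th(1) that by simp
      then show ?thesis
        using j ns(1,2) \<open>l < length es\<close> by (simp add: nth_eq_iff_index_eq)
    qed
    then have "tail (graph M) a = ns ! l \<longleftrightarrow> a = es ! l" for a
      using th(1)[OF that] by blast
    then show ?thesis by (simp add: out_arcs_def arcs)
  qed
  have in0: "in_arcs (graph M) (ns ! 0) = {}"
  proof -
    have "head (graph M) a \<noteq> ns ! 0" for a
    proof -
      obtain j where "j < length es" "a = es ! j" using idx by blast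
      then show ?thesis
        using th(2)[of j] nth_eq_iff_index_eq[OF ns(1), of "Suc j" 0] ns(2) by simp
    qed
    then show ?thesis by (auto simp: in_arcs_def)
  qed
  have inS: "in_arcs (graph M) (ns ! Suc l) = {es ! l}" if "l < length es" for l
  proof -
    have "a = es ! l" if "head (graph M) a = ns ! Suc l" for a
    proof -
      obtain j where j: "j < length es" "a = es ! j" using idx by blast
      then have "ns ! Suc j = ns ! Suc l" using th(2) that by simp
      then show ?thesis
        using j ns(1,2) \<open>l < length es\<close> by (simp add: nth_eq_iff_index_eq)
    qed
    then have "head (graph M) a = ns ! Suc l \<longleftrightarrow> a = es ! l" for a
      using th(2)[OF that] by blast
    then show ?thesis by (simp add: in_arcs_def arcs)
  qed
  have "edge_flow y (es ! l) t g = edge_flow y' (es ! l) t g" if "l < length es" for l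
    using that
  proof (induction l)
    case 0
    then have "ns ! 0 \<in> verts (graph M)" using ns by simp
    from admissible_conservation[OF y this, of g t] admissible_conservation[OF y' this, of g t]
    show ?case using in0 out[OF 0] by simp
  next
    case (Suc l)
    then have "ns ! Suc l \<in> verts (graph M)" using ns by simp
    from admissible_conservation[OF y this, of g t] admissible_conservation[OF y' this, of g t]
    show ?case using inS[of l] out[OF Suc.prems] Suc by simp
  qed
  then show ?thesis using idx by metis
qed

section \<open>Equilibrium conditions for a single edge and period\<close>

text \<open>With equal edge flows, whatever enters the express lane leaves the general one, so only
  the cost difference of the lanes counts.\<close>

lemma deviation_sum:
  assumes "\<And>e t. edge_flow y e t g = edge_flow y' e t g"
  shows "(\<Sum>e | P e. \<Sum>k\<in>UNIV. \<Sum>t\<in>UNIV. (y $ e $ k $ t $ g - y' $ e $ k $ t $ g) * c e k t)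
       = (\<Sum>e | P e. \<Sum>t\<in>UNIV.
            (y $ e $ Express $ t $ g - y' $ e $ Express $ t $ g) * (c e Express t - c e General t))"
proof -
  have G: "y $ e $ General $ t $ g - y' $ e $ General $ t $ g
      = - (y $ e $ Express $ t $ g - y' $ e $ Express $ t $ g)" for e t
    using assms[of e t] by (simp add: edge_flow_def)
  show ?thesis
    unfolding sum_lane G by (simp add: sum.distrib[symmetric] algebra_simps)
qed

text \<open>All admissible flows share their edge flows, so a deviation is a choice of express flow
  between 0 and the edge flow. Using only the cheaper lane makes each term of the deviation sum
  nonnegative.\<close>

lemma dbcp_equilibriumI:
  assumes path: "directed_path_graph (graph M)" "arcs (graph M) = UNIV"
    and y: "y \<in> admissible M"
    and low: "\<And>e t g. g \<in> groups_on M e \<Longrightarrow>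
      dbcp_cost M \<tau> \<alpha> y e Express t g < dbcp_cost M \<tau> \<alpha> y e General t g \<Longrightarrow>
      y $ e $ Express $ t $ g = edge_flow y e t g"
    and high: "\<And>e t g. g \<in> groups_on M e \<Longrightarrow>
      dbcp_cost M \<tau> \<alpha> y e Express t g > dbcp_cost M \<tau> \<alpha> y e General t g \<Longrightarrow>
      y $ e $ Express $ t $ g = 0"
  shows "dbcp_equilibrium M \<tau> \<alpha> y"
  unfolding dbcp_equilibrium_def equilibrium_def
proof (intro conjI allI ballI y)
  fix g y' assume y': "y' \<in> admissible M"
  have E: "edge_flow y' e t g = edge_flow y e t g" for e t
    by (rule edge_flow_unique[OF path y' y])
  have "0 \<le> (y' $ e $ Express $ t $ g - y $ e $ Express $ t $ g) *
      (dbcp_cost M \<tau> \<alpha> y e Express t g - dbcp_cost M \<tau> \<alpha> y e General t g)"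
    if g: "g \<in> groups_on M e" for e t
  proof -
    have "0 \<le> y' $ e $ Express $ t $ g" "y' $ e $ Express $ t $ g \<le> edge_flow y e t g"
      using flows_nonneg[OF admissible_flows[OF y'], of e Express t g]
        flows_nonneg[OF admissible_flows[OF y'], of e General t g] E[of e t]
      by (simp_all add: edge_flow_def)
    then show ?thesis
      using low[OF g, of t] high[OF g, of t]
      by (cases "dbcp_cost M \<tau> \<alpha> y e Express t g" "dbcp_cost M \<tau> \<alpha> y e General t g"
            rule: linorder_cases) (auto intro: mult_nonpos_nonpos)
  qed
  then show "0 \<le> (\<Sum>e | g \<in> groups_on M e. \<Sum>k\<in>UNIV. \<Sum>t\<in>UNIV.
      (y' $ e $ k $ t $ g - y $ e $ k $ t $ g) * dbcp_cost M \<tau> \<alpha> y e k t g)"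
    by (subst deviation_sum) (auto simp: E intro!: sum_nonneg)
qed

text \<open>
  An eligible group may exhaust its budget, so the only moves known to be feasible for it are those
  out of the express lane and those on a toll-free edge.
\<close>

lemma cbcp_equilibriumD:
  assumes path: "directed_path_graph (graph M)" "arcs (graph M) = UNIV"
    and \<tau>: "\<tau> \<in> tolls"
    and eq: "cbcp_equilibrium M \<tau> B y"
    and g: "g \<in> groups_on M e"
    and w: "0 \<le> w" "w \<le> edge_flow y e t g"
    and aff: "g \<notin> eligible M \<or> \<tau> $ e $ t = 0 \<or> w \<le> y $ e $ Express $ t $ g"
  shows "0 \<le> (w - y $ e $ Express $ t $ g) *
    (cbcp_cost M \<tau> y e Express t g - cbcp_cost M \<tau> y e General t g)"
proof -
  \<comment> \<open>The deviation changes a single entry of the express flows.\<close>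
  define z where "z = (\<lambda>e' t' g'. if e' = e \<and> t' = t \<and> g' = g then w
    else y $ e' $ Express $ t' $ g')"
  define y' where "y' = relane M y z"
  have y: "y \<in> cbcp_feasible M \<tau> B"
    using eq by (simp add: cbcp_equilibrium_def equilibrium_def)
  then have ya: "y \<in> admissible M"
    by (simp add: cbcp_feasible_def)
  note y0 = flows_nonneg[OF admissible_flows[OF ya]]
  have y'a: "y' \<in> admissible M"
    unfolding y'_def using ya by (rule relane_admissible) (use w y0 in \<open>auto simp: z_def edge_flow_def\<close>)
  \<comment> \<open>No eligible group spends more: at the changed entry the group is ineligible, the
    toll is zero or the express flow does not grow.\<close>
  have "y' $ e' $ Express $ t' $ g' * \<tau> $ e' $ t' \<le> y $ e' $ Express $ t' $ g' * \<tau> $ e' $ t'"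
    if "g' \<in> eligible M" "g' \<in> groups_on M e'" for e' t' g'
    using that aff \<tau> mult_right_mono[of w "y $ e $ Express $ t $ g" "\<tau> $ e $ t"]
    by (auto simp: y'_def z_def tolls_def)
  then have "(\<Sum>t'\<in>UNIV. \<Sum>e' | g' \<in> groups_on M e'. y' $ e' $ Express $ t' $ g' * \<tau> $ e' $ t')
      \<le> (\<Sum>t'\<in>UNIV. \<Sum>e' | g' \<in> groups_on M e'. y $ e' $ Express $ t' $ g' * \<tau> $ e' $ t')"
    if "g' \<in> eligible M" for g'
    using that by (intro sum_mono) auto
  with y y'a have "y' \<in> cbcp_feasible M \<tau> B"
    by (fastforce simp: cbcp_feasible_def)
  with eq have "0 \<le> (\<Sum>e' | g \<in> groups_on M e'. \<Sum>k\<in>UNIV. \<Sum>t'\<in>UNIV.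
      (y' $ e' $ k $ t' $ g - y $ e' $ k $ t' $ g) * cbcp_cost M \<tau> y e' k t' g)"
    by (simp add: cbcp_equilibrium_def equilibrium_def)
  also have "\<dots> = (\<Sum>e' | g \<in> groups_on M e'. \<Sum>t'\<in>UNIV.
      (y' $ e' $ Express $ t' $ g - y $ e' $ Express $ t' $ g) *
      (cbcp_cost M \<tau> y e' Express t' g - cbcp_cost M \<tau> y e' General t' g))"
    by (rule deviation_sum) (rule edge_flow_unique[OF path y'a ya])
  also have "\<dots> = (\<Sum>e' | g \<in> groups_on M e'. \<Sum>t'\<in>UNIV. if e' = e \<and> t' = t then
      (w - y $ e $ Express $ t $ g) *
      (cbcp_cost M \<tau> y e Express t g - cbcp_cost M \<tau> y e General t g) else 0)"
    by (intro sum.cong) (auto simp: y'_def z_def)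
  also have "\<dots> = (\<Sum>e' | g \<in> groups_on M e'. if e' = e then
      (w - y $ e $ Express $ t $ g) *
      (cbcp_cost M \<tau> y e Express t g - cbcp_cost M \<tau> y e General t g) else 0)"
    by (intro sum.cong) auto
  also have "\<dots> = (w - y $ e $ Express $ t $ g) *
      (cbcp_cost M \<tau> y e Express t g - cbcp_cost M \<tau> y e General t g)"
    using g by simp
  finally show ?thesis .
qed

section \<open>Greedy assignment and its price\<close>

text \<open>Fill the groups greedily, by decreasing \<open>v\<close>; \<open>m\<close> is the group at which \<open>X\<close> runs out.\<close>

lemma greedy_split:
  fixes d v :: "'g \<Rightarrow> real"
  assumes "finite A" "\<And>g. g \<in> A \<Longrightarrow> 0 \<le> d g" "0 < X" "X \<le> sum d A"
  shows "\<exists>m\<in>A. 0 < d m \<and> (\<exists>z. (\<forall>g\<in>A. 0 \<le> z g \<and> z g \<le> d g) \<and> sum z A = X \<and>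
    (\<forall>g\<in>A. (v m < v g \<longrightarrow> z g = d g) \<and> (v g < v m \<longrightarrow> z g = 0)))"
  using assms
\<comment> \<open>The induction inserts an element \<open>a\<close> whose \<open>v\<close> is at
  least that of all of \<open>A\<close>, so \<open>a\<close> is served first and the rest of
  \<open>X\<close> goes to \<open>A\<close>.\<close>
proof (induction A arbitrary: X rule: finite_ranking_induct[where f = v])
  case empty
  then show ?case by simp
next
  case (insert a A)
  show ?case
  proof (cases "a \<in> A")
    case True
    then have "insert a A = A" by blast
    with insert show ?thesis by simp
  next
    case a: False
    show ?thesis
    proof (cases "X \<le> d a")
      case True
      have "(\<Sum>g\<in>A. if g = a then X else 0) = 0"
        using a by (intro sum.neutral) auto
      then show ?thesis
        using insert True a
        by (intro bexI[of _ a] conjI exI[of _ "\<lambda>g. if g = a then X else 0"]) (fastforce)+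
    next
      case False
      then have "0 < X - d a" "X - d a \<le> sum d A"
        using insert a by auto
      then obtain m z where m: "m \<in> A" "0 < d m" and z: "\<forall>g\<in>A. 0 \<le> z g \<and> z g \<le> d g"
          "sum z A = X - d a" "\<forall>g\<in>A. (v m < v g \<longrightarrow> z g = d g) \<and> (v g < v m \<longrightarrow> z g = 0)"
        using insert.IH[of "X - d a"] insert.prems by blast
      have "sum (z(a := d a)) A = sum z A"
        using a by (intro sum.cong) auto
      then have "sum (z(a := d a)) (insert a A) = X"
        using a z(2) insert.hyps by simp
      moreover have "v m \<le> v a" using insert.hyps m by blast
      ultimately show ?thesis
        using m z insert.prems a by (intro bexI[of _ m] conjI exI[of _ "z(a := d a)"]) auto
    qed
  qed
qed

text \<open>\<open>\<delta>\<close> is the latency saved on the express lane and \<open>p\<close> the discounted toll.\<close>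

lemma price_split:
  fixes s v y :: "'g \<Rightarrow> real"
  assumes "finite A"
    and y: "\<And>g. g \<in> A \<Longrightarrow> 0 \<le> y g \<and> y g \<le> s g"
    and v: "\<And>g. g \<in> A \<Longrightarrow> 0 < v g"
    and \<delta>: "0 \<le> \<delta>" and \<tau>: "0 \<le> \<tau>"
    and le: "\<And>g. g \<in> A \<Longrightarrow> 0 < \<delta> \<Longrightarrow> 0 < s g \<Longrightarrow> v g * \<delta> \<le> \<tau>"
  shows "\<exists>p z. 0 \<le> p \<and> p \<le> \<tau> \<and> sum z A = sum y A \<and> (0 < \<delta> \<longrightarrow> 0 < sum y A \<longrightarrow> 0 < p) \<and>
    (\<forall>g\<in>A. 0 \<le> z g \<and> z g \<le> s g \<and> (p < v g * \<delta> \<longrightarrow> z g = s g) \<and> (v g * \<delta> < p \<longrightarrow> z g = 0))"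
proof -
  consider "\<delta> = 0" | "0 < \<delta>" "sum y A = 0" | "0 < \<delta>" "0 < sum y A"
    using \<delta> sum_nonneg[of A y] y by fastforce
  then show ?thesis
  proof cases
    case 1
    \<comment> \<open>At price 0 every group is indifferent, so \<open>y\<close> may stay.\<close>
    then show ?thesis
      using y \<tau> by (intro exI[of _ 0] exI[of _ y]) auto
  next
    case 2
    then have "y g = 0" if "g \<in> A" for g
      using that y \<open>finite A\<close> by (meson sum_nonneg_eq_0_iff)
    \<comment> \<open>At price \<tau> nobody needs to enter: a group valuing the gap above \<tau>
      has no traffic, by \<open>le\<close>.\<close>
    moreover have "0 = s g" if "g \<in> A" "\<tau> < v g * \<delta>" for g
      using le[OF that(1) 2(1)] y[OF that(1)] that(2) by linarith
    ultimately show ?thesis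
      using 2 y \<tau> by (intro exI[of _ \<tau>] exI[of _ y]) auto
  next
    case 3
    have "sum y A \<le> sum s A" using y by (intro sum_mono) blast
    moreover have "0 \<le> s g" if "g \<in> A" for g using y[OF that] by linarith
    ultimately obtain m z where m: "m \<in> A" "0 < s m" and z: "\<forall>g\<in>A. 0 \<le> z g \<and> z g \<le> s g"
        "sum z A = sum y A" "\<forall>g\<in>A. (v m < v g \<longrightarrow> z g = s g) \<and> (v g < v m \<longrightarrow> z g = 0)"
      using greedy_split[OF \<open>finite A\<close>, of s "sum y A" v] 3 by blast
    \<comment> \<open>The price is the value of the gap to the marginal group \<open>m\<close>;
      since \<open>0 < s m\<close>, \<open>le\<close> bounds it by \<tau>.\<close>
    then show ?thesis
      using 3 v[OF m(1)] le[OF m(1) 3(1) m(2)]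
      by (intro exI[of _ "v m * \<delta>"] exI[of _ z]) auto
  qed
qed

section \<open>Latency gap and tolls at a CBCP equilibrium\<close>

lemma lane_flow_relane:
  "lane_flow M (relane M y z) $ e $ Express $ t = (\<Sum>g\<in>groups_on M e. z e t g)"
  "lane_flow M (relane M y z) $ e $ General $ t =
     (\<Sum>g\<in>groups_on M e. edge_flow y e t g) - (\<Sum>g\<in>groups_on M e. z e t g)"
  by (simp_all add: lane_flow_def sum_subtractf)

lemma edge_flow_relane:
  "g \<in> groups_on M e \<Longrightarrow> edge_flow (relane M y z) e t g = edge_flow y e t g"
  by (simp add: edge_flow_def)

lemma dbcp_cost_less_iff:
  "dbcp_cost M \<tau> \<alpha> y e Express t g < dbcp_cost M \<tau> \<alpha> y e General t g \<longleftrightarrow>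
     (if g \<in> eligible M then (1 - \<alpha> $ e $ t) * \<tau> $ e $ t else \<tau> $ e $ t)
       < vot M g t * (latency M e (lane_flow M y $ e $ General $ t)
                      - latency M e (lane_flow M y $ e $ Express $ t))"
  "dbcp_cost M \<tau> \<alpha> y e General t g < dbcp_cost M \<tau> \<alpha> y e Express t g \<longleftrightarrow>
     vot M g t * (latency M e (lane_flow M y $ e $ General $ t)
                      - latency M e (lane_flow M y $ e $ Express $ t)) <
     (if g \<in> eligible M then (1 - \<alpha> $ e $ t) * \<tau> $ e $ t else \<tau> $ e $ t)"
  by (auto simp: dbcp_cost_def algebra_simps)

text \<open>
  If at \<open>(e, t)\<close> the groups with a higher value of time than \<open>g\<close> made up less than half of the
  traffic, then sending them and a little of \<open>g\<close> to the express lane would be an equilibrium for the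
  toll that makes \<open>g\<close> indifferent; all other edges and periods are toll-free and split evenly.
\<close>

lemma higher_vot_majority:
  fixes M :: "('v, 'e::finite, 't::finite, 'g::finite) tolled_network"
  assumes path: "directed_path_graph (graph M)" "arcs (graph M) = UNIV"
    and mono: "strict_mono_on {0..} (latency M e)"
    and vot: "\<And>g t. 0 < vot M g t"
    and no_elig: "\<And>\<tau> y e t g. \<tau> \<in> tolls \<Longrightarrow> dbcp_equilibrium M \<tau> 0 y \<Longrightarrow> 0 < \<tau> $ e $ t \<Longrightarrow>
           g \<in> elig_on M e \<Longrightarrow> y $ e $ Express $ t $ g = 0"
    and y: "y \<in> admissible M"
    and g: "g \<in> elig_on M e" "0 < edge_flow y e t g"
  shows "(\<Sum>g'\<in>groups_on M e. edge_flow y e t g') / 2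
    \<le> (\<Sum>g' | g' \<in> groups_on M e \<and> vot M g t < vot M g' t. edge_flow y e t g')"
proof (rule ccontr)
  define S where "S = (\<Sum>g'\<in>groups_on M e. edge_flow y e t g')"
  define H where "H = (\<Sum>g' | g' \<in> groups_on M e \<and> vot M g t < vot M g' t. edge_flow y e t g')"
  assume "\<not> ?thesis"
  then have HS: "H < S / 2" by (simp add: S_def H_def)
  have gG: "g \<in> groups_on M e" and gE: "g \<in> eligible M" using g by (auto simp: elig_on_def)
  have s0: "0 \<le> edge_flow y e t g" for e t g
    using flows_nonneg[OF admissible_flows[OF y]] by (simp add: edge_flow_def)
  have H0: "0 \<le> H" unfolding H_def by (intro sum_nonneg s0)
  \<comment> \<open>At most half of the slack below \<open>S / 2\<close> is used, so the express
    lane stays strictly less loaded and the gap is positive.\<close>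
  define \<epsilon> where "\<epsilon> = min (edge_flow y e t g) ((S / 2 - H) / 2)"
  have \<epsilon>: "0 < \<epsilon>" "\<epsilon> \<le> edge_flow y e t g" "H + \<epsilon> < S / 2"
    using g HS unfolding \<epsilon>_def by (auto simp: min_def field_simps)
  define \<delta> where "\<delta> = latency M e (S - (H + \<epsilon>)) - latency M e (H + \<epsilon>)"
  have \<delta>: "0 < \<delta>"
    using strict_mono_onD[OF mono, of "H + \<epsilon>" "S - (H + \<epsilon>)"] H0 \<epsilon> by (auto simp: \<delta>_def)
  define z where "z = (\<lambda>e' t' g'. if e' = e \<and> t' = t
    then (if vot M g t < vot M g' t then edge_flow y e t g' else if g' = g then \<epsilon> else 0)
    else edge_flow y e' t' g' / 2)"
  define \<tau> :: "('e, 't) edge_vec" where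
    "\<tau> = (\<chi> e' t'. if e' = e \<and> t' = t then vot M g t * \<delta> else 0)"
  define y' where "y' = relane M y z"
  have y'a: "y' \<in> admissible M"
    unfolding y'_def using y by (rule relane_admissible) (use \<epsilon> s0 in \<open>auto simp: z_def\<close>)
  have "(\<Sum>g'\<in>groups_on M e. z e t g') =
      (\<Sum>g'\<in>groups_on M e. if vot M g t < vot M g' t then edge_flow y e t g' else 0) +
      (\<Sum>g'\<in>groups_on M e. if g' = g then \<epsilon> else 0)"
    unfolding sum.distrib[symmetric] by (intro sum.cong) (auto simp: z_def)
  also have "\<dots> = H + \<epsilon>"
    using gG by (simp add: H_def sum.inter_filter[symmetric])
  finally have zsum: "(\<Sum>g'\<in>groups_on M e. z e t g') = H + \<epsilon>" .
  have gap: "latency M e' (lane_flow M y' $ e' $ General $ t')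
      - latency M e' (lane_flow M y' $ e' $ Express $ t') = (if e' = e \<and> t' = t then \<delta> else 0)"
    for e' t'
  proof (cases "e' = e \<and> t' = t")
    case True
    then show ?thesis
      unfolding y'_def lane_flow_relane by (simp add: zsum \<delta>_def S_def)
  next
    case False
    then have half: "(\<Sum>g\<in>groups_on M e'. z e' t' g) = (\<Sum>g\<in>groups_on M e'. edge_flow y e' t' g) / 2"
      unfolding sum_divide_distrib by (intro sum.cong) (auto simp: z_def)
    show ?thesis
      unfolding y'_def lane_flow_relane half using False by auto
  qed
  have "\<tau> \<in> tolls"
    using \<delta> vot[of g t] by (simp add: tolls_def \<tau>_def)
  moreover have "dbcp_equilibrium M \<tau> 0 y'"
  proof (rule dbcp_equilibriumI[OF path y'a])
    fix e' t' g' assume G: "g' \<in> groups_on M e'"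
    assume "dbcp_cost M \<tau> 0 y' e' Express t' g' < dbcp_cost M \<tau> 0 y' e' General t' g'"
    then show "y' $ e' $ Express $ t' $ g' = edge_flow y' e' t' g'"
      using G \<delta> unfolding dbcp_cost_less_iff gap
      by (auto simp: \<tau>_def z_def y'_def edge_flow_relane split: if_splits)
  next
    fix e' t' g' assume G: "g' \<in> groups_on M e'"
    assume "dbcp_cost M \<tau> 0 y' e' General t' g' < dbcp_cost M \<tau> 0 y' e' Express t' g'"
    then show "y' $ e' $ Express $ t' $ g' = 0"
      using G \<delta> unfolding dbcp_cost_less_iff gap
      by (auto simp: \<tau>_def z_def y'_def split: if_splits)
  qed
  \<comment> \<open>The toll is positive although the eligible group \<open>g\<close> sends
    \<epsilon> over the express lane, against \<open>no_elig\<close>.\<close>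
  moreover have "0 < \<tau> $ e $ t"
    using \<delta> vot[of g t] by (simp add: \<tau>_def)
  ultimately have "y' $ e $ Express $ t $ g = 0"
    using no_elig g(1) by blast
  then show False
    using gG \<epsilon>(1) by (simp add: y'_def z_def)
qed

text \<open>The first two facts say that ineligible groups already choose lanes as a DBCP
  equilibrium requires; the last two supply the hypotheses of \<open>price_split\<close> for the
  eligible ones.\<close>

lemma cbcp_edge_facts:
  fixes M :: "('v, 'e::finite, 't::finite, 'g::finite) tolled_network"
    and y :: "('e, 't, 'g) flow" and \<tau> :: "('e, 't) edge_vec" and e :: 'e and t :: 't
  defines "\<delta> \<equiv> latency M e (lane_flow M y $ e $ General $ t)
                - latency M e (lane_flow M y $ e $ Express $ t)"
  assumes path: "directed_path_graph (graph M)" "arcs (graph M) = UNIV"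
    and mono: "strict_mono_on {0..} (latency M e)"
    and vot: "\<And>g t. 0 < vot M g t"
    and no_elig: "\<And>\<tau> y e t g. \<tau> \<in> tolls \<Longrightarrow> dbcp_equilibrium M \<tau> 0 y \<Longrightarrow> 0 < \<tau> $ e $ t \<Longrightarrow>
           g \<in> elig_on M e \<Longrightarrow> y $ e $ Express $ t $ g = 0"
    and \<tau>: "\<tau> \<in> tolls"
    and eq: "cbcp_equilibrium M \<tau> B y"
  shows cbcp_inelig_express:
      "\<And>g. g \<in> inelig_on M e \<Longrightarrow> \<tau> $ e $ t < vot M g t * \<delta> \<Longrightarrow>
         y $ e $ Express $ t $ g = edge_flow y e t g"
    and cbcp_inelig_general:
      "\<And>g. g \<in> inelig_on M e \<Longrightarrow> vot M g t * \<delta> < \<tau> $ e $ t \<Longrightarrow> y $ e $ Express $ t $ g = 0"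
    and cbcp_gap_nonneg: "0 \<le> \<delta>"
    and cbcp_elig_le_toll:
      "\<And>g. g \<in> elig_on M e \<Longrightarrow> 0 < \<delta> \<Longrightarrow> 0 < edge_flow y e t g \<Longrightarrow> vot M g t * \<delta> \<le> \<tau> $ e $ t"
proof -
  have ya: "y \<in> admissible M"
    using eq by (simp add: cbcp_equilibrium_def equilibrium_def cbcp_feasible_def)
  note y0 = flows_nonneg[OF admissible_flows[OF ya]]
  let ?x1 = "lane_flow M y $ e $ Express $ t" and ?x2 = "lane_flow M y $ e $ General $ t"
  have s: "y $ e $ Express $ t $ g \<le> edge_flow y e t g" "0 \<le> edge_flow y e t g" for g
    using y0[of e _ t g] by (simp_all add: edge_flow_def)
  have x0: "0 \<le> lane_flow M y $ e $ k $ t" for k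
    by (simp add: lane_flow_def sum_nonneg y0)
  have \<tau>0: "0 \<le> \<tau> $ e $ t" using \<tau> by (simp add: tolls_def)
  have dev: "(w - y $ e $ Express $ t $ g) * (vot M g t * \<delta>) \<le>
      (w - y $ e $ Express $ t $ g) * (if g \<in> eligible M then 0 else \<tau> $ e $ t)"
    if "g \<in> groups_on M e" "0 \<le> w" "w \<le> edge_flow y e t g"
      "g \<notin> eligible M \<or> \<tau> $ e $ t = 0 \<or> w \<le> y $ e $ Express $ t $ g" for g w
    using cbcp_equilibriumD[OF path \<tau> eq that]
    by (simp add: cbcp_cost_def \<delta>_def algebra_simps split: if_splits)
  show ex: "y $ e $ Express $ t $ g = edge_flow y e t g"
    if "g \<in> inelig_on M e" "\<tau> $ e $ t < vot M g t * \<delta>" for g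
    using dev[of g "edge_flow y e t g"] s[of g] that
    by (fastforce simp: inelig_on_def mult_le_cancel_left)
  show gen: "y $ e $ Express $ t $ g = 0"
    if "g \<in> inelig_on M e" "vot M g t * \<delta> < \<tau> $ e $ t" for g
    using dev[of g 0] s[of g] y0[of e Express t g] that
    by (fastforce simp: inelig_on_def mult_le_cancel_left)
  have free: "y $ e $ Express $ t $ g = edge_flow y e t g"
    if "g \<in> elig_on M e" "\<tau> $ e $ t = 0" "0 < \<delta>" for g
    using dev[of g "edge_flow y e t g"] s[of g] that vot[of g t] mult_pos_pos[OF vot[of g t] \<open>0 < \<delta>\<close>]
    by (auto simp: elig_on_def mult_le_0_iff)
  \<comment> \<open>Leaving the express lane never violates a budget, so it is a feasible deviation
    for every eligible group.\<close>
  have slow: "y $ e $ Express $ t $ g = 0" if "g \<in> elig_on M e" "\<delta> < 0" for g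
    using dev[of g 0] s[of g] y0[of e Express t g] that vot[of g t] mult_pos_neg[OF vot[of g t] \<open>\<delta> < 0\<close>]
    by (auto simp: elig_on_def mult_le_0_iff zero_le_mult_iff)
  have split: "g \<in> elig_on M e \<or> g \<in> inelig_on M e" if "g \<in> groups_on M e" for g
    using that by (auto simp: elig_on_def inelig_on_def)
  show \<delta>0: "0 \<le> \<delta>"
  proof (rule ccontr)
    assume n: "\<not> 0 \<le> \<delta>"
    \<comment> \<open>A negative gap would empty the express lane, but an empty lane is no slower
      than the other one.\<close>
    then have "y $ e $ Express $ t $ g = 0" if "g \<in> groups_on M e" for g
      using split[OF that] slow[of g] gen[of g] mult_pos_neg[OF vot[of g t], of \<delta>] \<tau>0 by force
    then have "?x1 = 0" by (simp add: lane_flow_def)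
    with x0 have "latency M e ?x1 \<le> latency M e ?x2"
      using strict_mono_on_leD[OF mono, of ?x1 ?x2] by auto
    with n show False by (simp add: \<delta>_def)
  qed
  fix g assume g: "g \<in> elig_on M e" and \<delta>: "0 < \<delta>" and sg: "0 < edge_flow y e t g"
  \<comment> \<open>Among the eligible groups with traffic here it suffices to treat one,
    \<open>m\<close>, with the highest value of time.\<close>
  define A where "A = {g \<in> elig_on M e. 0 < edge_flow y e t g}"
  have "finite A" "A \<noteq> {}" using g sg by (auto simp: A_def)
  then have "Max ((\<lambda>g. vot M g t) ` A) \<in> (\<lambda>g. vot M g t) ` A" by (intro Max_in) auto
  then obtain m where m: "m \<in> A" and mMax: "vot M m t = Max ((\<lambda>g. vot M g t) ` A)" by auto
  have mmax: "vot M g' t \<le> vot M m t" if "g' \<in> A" for g'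
    unfolding mMax using that \<open>finite A\<close> by (intro Max_ge) auto
  have "?x1 < ?x2"
    using \<delta> strict_mono_on_leD[OF mono, of ?x2 ?x1] x0 by (force simp: \<delta>_def)
  moreover have "?x1 + ?x2 = (\<Sum>g\<in>groups_on M e. edge_flow y e t g)"
    by (simp add: lane_flow_def edge_flow_def sum.distrib)
  ultimately have half: "?x1 < (\<Sum>g\<in>groups_on M e. edge_flow y e t g) / 2"
    by simp
  have "vot M m t * \<delta> \<le> \<tau> $ e $ t"
  proof (rule ccontr)
    assume n: "\<not> vot M m t * \<delta> \<le> \<tau> $ e $ t"
    \<comment> \<open>If \<open>m\<close> valued the gap above the toll, all traffic with a higher
      value of time would be ineligible, hence entirely on the express lane, which carries less than
      half.\<close>
    have "edge_flow y e t g' \<le> y $ e $ Express $ t $ g'"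
      if g': "g' \<in> groups_on M e" "vot M m t < vot M g' t" for g'
    proof (cases "g' \<in> eligible M")
      case True
      then have "g' \<notin> A" using mmax[of g'] g' by auto
      then have "edge_flow y e t g' \<le> 0" using True g' by (simp add: A_def elig_on_def)
      then show ?thesis using y0 by (rule order_trans)
    next
      case False
      then have "g' \<in> inelig_on M e" using g' by (simp add: inelig_on_def)
      moreover have "vot M m t * \<delta> \<le> vot M g' t * \<delta>" using g' \<delta> by simp
      ultimately show ?thesis using ex[of g'] n by simp
    qed
    then have "(\<Sum>g' | g' \<in> groups_on M e \<and> vot M m t < vot M g' t. edge_flow y e t g')
        \<le> (\<Sum>g' | g' \<in> groups_on M e \<and> vot M m t < vot M g' t. y $ e $ Express $ t $ g')"
      by (intro sum_mono) auto
    also have "\<dots> \<le> ?x1"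
      unfolding lane_flow_def by (simp, intro sum_mono2) (auto intro: y0)
    finally show False
      using half m higher_vot_majority[OF path mono vot no_elig ya, where g = m and t = t] by (simp add: A_def)
  qed
  moreover have "vot M g t * \<delta> \<le> vot M m t * \<delta>"
    using mmax[of g] g sg \<delta> by (simp add: A_def)
  ultimately show "vot M g t * \<delta> \<le> \<tau> $ e $ t" by linarith
qed

section \<open>Strict improvement of the objective\<close>

text \<open>
  The objectives agree on ineligible groups. For eligible ones, \<open>a\<close> and \<open>b\<close> are the latencies, and
  \<open>z\<close> is optimal at the price \<open>p\<close> among the splits with the same total.
\<close>

lemma split_cost_le:
  fixes s v y z :: "'g \<Rightarrow> real"
  assumes y: "\<And>g. g \<in> A \<Longrightarrow> 0 \<le> y g \<and> y g \<le> s g"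
    and z: "\<And>g. g \<in> A \<Longrightarrow> p < v g * (b - a) \<Longrightarrow> z g = s g"
      "\<And>g. g \<in> A \<Longrightarrow> v g * (b - a) < p \<Longrightarrow> z g = 0"
    and tot: "sum z A = sum y A" and lE: "0 \<le> lE"
  shows "lE * (\<Sum>g\<in>A. (v g * a + p) * z g + v g * b * (s g - z g)) - lR * (\<Sum>g\<in>A. p * z g)
    \<le> lE * (\<Sum>g\<in>A. v g * a * y g + v g * b * (s g - y g)) - (lR - lE) * (p * sum y A)"
proof -
  \<comment> \<open>A positive first factor forces \<open>z g = s g\<close>, a negative one
    \<open>z g = 0\<close>; both agree in sign with \<open>z g - y g\<close>.\<close>
  have "0 \<le> (v g * (b - a) - p) * (z g - y g)" if "g \<in> A" for g
    using y[OF that] z[OF that]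
    by (cases p "v g * (b - a)" rule: linorder_cases) (auto intro: mult_nonpos_nonneg)
  then have "0 \<le> (\<Sum>g\<in>A. (v g * (b - a) - p) * (z g - y g))"
    by (rule sum_nonneg)
  also have "\<dots> = (\<Sum>g\<in>A. v g * a * y g + v g * b * (s g - y g)) -
      (\<Sum>g\<in>A. (v g * a + p) * z g + v g * b * (s g - z g)) + p * sum y A"
    by (simp add: sum_subtractf[symmetric] sum.distrib[symmetric] sum_distrib_left algebra_simps)
  finally have "(\<Sum>g\<in>A. (v g * a + p) * z g + v g * b * (s g - z g))
      \<le> (\<Sum>g\<in>A. v g * a * y g + v g * b * (s g - y g)) + p * sum y A" by simp
  from mult_left_mono[OF this lE] show ?thesis
    by (simp add: sum_distrib_left[symmetric] tot algebra_simps)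
qed

theorem corollary5p7:
  fixes M :: "('v, 'e::finite, 't::finite, 'g::finite) tolled_network"
    and h :: "('e, 't, 'g) flow \<times> ('e, 't) edge_vec \<Rightarrow> real ^ 'n"
    and lE lR lI :: real
  assumes "chain_instance M"
    and "0 \<le> lE" "0 \<le> lR" "0 \<le> lI"
    and "continuous_on (admissible M \<times> UNIV) h"
    and "bounded {(y, \<tau>) \<in> admissible M \<times> UNIV. h (y, \<tau>) \<le> 0}"
    and "\<And>\<tau> y y'. \<tau> \<in> tolls \<Longrightarrow> y \<in> admissible M \<Longrightarrow> y' \<in> admissible M \<Longrightarrow>
           (\<forall>e k t. (\<Sum>g\<in>elig_on M e. y $ e $ k $ t $ g) = (\<Sum>g\<in>elig_on M e. y' $ e $ k $ t $ g) \<and>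
                    (\<forall>g\<in>inelig_on M e. y $ e $ k $ t $ g = y' $ e $ k $ t $ g)) \<Longrightarrow>
           h (y, \<tau>) = h (y', \<tau>)"
    and "\<And>\<tau> y e t g. \<tau> \<in> tolls \<Longrightarrow> dbcp_equilibrium M \<tau> 0 y \<Longrightarrow> 0 < \<tau> $ e $ t \<Longrightarrow>
           g \<in> elig_on M e \<Longrightarrow> y $ e $ Express $ t $ g = 0"
    and "\<exists>(y, x, \<tau>, B) \<in> cbcp_minimizers M h lE lR lI. \<exists>e t. \<exists>g\<in>elig_on M e.
           0 < y $ e $ Express $ t $ g \<and> x $ e $ Express $ t < x $ e $ General $ t"
    and "lE < lR"
    and "cbcp_set M h \<noteq> {}" and "dbcp_set M h \<noteq> {}"
  shows "dbcp_inf M h lE lR lI < cbcp_inf M h lE lR lI"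
proof -
  have path: "directed_path_graph (graph M)" "arcs (graph M) = UNIV"
    and mono: "\<And>e. strict_mono_on {0..} (latency M e)"
    and vot: "\<And>g t. 0 < vot M g t"
    using assms(1) by (simp_all add: chain_instance_def)
  note inv = assms(7) and no_elig = assms(8)
  obtain y x \<tau> B e0 t0 g0 where min: "(y, x, \<tau>, B) \<in> cbcp_minimizers M h lE lR lI"
    and g0: "g0 \<in> elig_on M e0" "0 < y $ e0 $ Express $ t0 $ g0"
      "x $ e0 $ Express $ t0 < x $ e0 $ General $ t0"
    using assms(9) by blast
  from min have \<tau>: "\<tau> \<in> tolls" and eq: "cbcp_equilibrium M \<tau> B y" and x: "x = lane_flow M y"
    and hy: "h (y, \<tau>) \<le> 0"
    and inf: "cbcp_inf M h lE lR lI = ereal (cbcp_objective M lE lR lI y x \<tau>)"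
    by (auto simp: cbcp_minimizers_def cbcp_set_def)
  have ya: "y \<in> admissible M"
    using eq by (simp add: cbcp_equilibrium_def equilibrium_def cbcp_feasible_def)
  note y0 = flows_nonneg[OF admissible_flows[OF ya]]
  define \<delta> where "\<delta> = (\<lambda>e t. latency M e (x $ e $ General $ t) - latency M e (x $ e $ Express $ t))"
  note facts = cbcp_edge_facts[OF path mono vot no_elig \<tau> eq, folded x]
  have ys: "0 \<le> y $ e $ Express $ t $ g" "y $ e $ Express $ t $ g \<le> edge_flow y e t g" for e t g
    using y0[of e _ t g] by (simp_all add: edge_flow_def)
  have \<tau>0: "0 \<le> \<tau> $ e $ t" for e t using \<tau> by (simp add: tolls_def)
  have "\<exists>p z. 0 \<le> p \<and> p \<le> \<tau> $ e $ t \<and>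
      sum z (elig_on M e) = (\<Sum>g\<in>elig_on M e. y $ e $ Express $ t $ g) \<and>
      (0 < \<delta> e t \<longrightarrow> 0 < (\<Sum>g\<in>elig_on M e. y $ e $ Express $ t $ g) \<longrightarrow> 0 < p) \<and>
      (\<forall>g\<in>elig_on M e. 0 \<le> z g \<and> z g \<le> edge_flow y e t g \<and>
        (p < vot M g t * \<delta> e t \<longrightarrow> z g = edge_flow y e t g) \<and>
        (vot M g t * \<delta> e t < p \<longrightarrow> z g = 0))" for e t
    unfolding \<delta>_def using facts(3,4) ys vot \<tau>0 by (intro price_split) auto
  then obtain p z0 where p: "\<And>e t. 0 \<le> p e t" "\<And>e t. p e t \<le> \<tau> $ e $ t"
    and tot: "\<And>e t. sum (z0 e t) (elig_on M e) = (\<Sum>g\<in>elig_on M e. y $ e $ Express $ t $ g)"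
    and pos: "\<And>e t. 0 < \<delta> e t \<Longrightarrow> 0 < (\<Sum>g\<in>elig_on M e. y $ e $ Express $ t $ g) \<Longrightarrow> 0 < p e t"
    and z0: "\<And>e t g. g \<in> elig_on M e \<Longrightarrow> 0 \<le> z0 e t g \<and> z0 e t g \<le> edge_flow y e t g"
      "\<And>e t g. g \<in> elig_on M e \<Longrightarrow> p e t < vot M g t * \<delta> e t \<Longrightarrow> z0 e t g = edge_flow y e t g"
      "\<And>e t g. g \<in> elig_on M e \<Longrightarrow> vot M g t * \<delta> e t < p e t \<Longrightarrow> z0 e t g = 0"
    by metis
  \<comment> \<open>Eligible groups follow the greedy assignment, ineligible ones keep their express
    flows.\<close>
  define z where "z = (\<lambda>e t g. if g \<in> eligible M then z0 e t g else y $ e $ Express $ t $ g)"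
  define y' where "y' = relane M y z"
  \<comment> \<open>The discount turns the toll into \<open>p\<close>. Where the toll is 0, so is
    \<open>p\<close>, and the default discount 0 is correct.\<close>
  define \<alpha> :: "('e, 't) edge_vec" where
    "\<alpha> = (\<chi> e t. if \<tau> $ e $ t = 0 then 0 else 1 - p e t / \<tau> $ e $ t)"
  have \<alpha>p: "(1 - \<alpha> $ e $ t) * \<tau> $ e $ t = p e t" for e t
    using p[where e = e and t = t] by (auto simp: \<alpha>_def)
  have \<alpha>: "\<alpha> \<in> discounts"
    using p \<tau>0 by (auto simp: discounts_def \<alpha>_def divide_le_eq_1 less_le)
  have y'a: "y' \<in> admissible M"
    unfolding y'_def using ya
    by (rule relane_admissible) (use z0(1) ys in \<open>auto simp: z_def elig_on_def\<close>)
  have inel: "y' $ e $ k $ t $ g = y $ e $ k $ t $ g" if "g \<in> inelig_on M e" for e k t g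
    using that by (cases k) (auto simp: y'_def z_def inelig_on_def edge_flow_def)
  have el: "y' $ e $ Express $ t $ g = z0 e t g"
    "y' $ e $ General $ t $ g = edge_flow y e t g - z0 e t g" if "g \<in> elig_on M e" for e t g
    using that by (auto simp: y'_def z_def elig_on_def)
  have same: "(\<Sum>g\<in>elig_on M e. y' $ e $ k $ t $ g) = (\<Sum>g\<in>elig_on M e. y $ e $ k $ t $ g)" for e k t
    by (cases k) (simp_all add: el tot sum_subtractf, simp add: edge_flow_def sum.distrib)
  have x': "lane_flow M y' = x"
  proof -
    have "groups_on M e = elig_on M e \<union> inelig_on M e" "elig_on M e \<inter> inelig_on M e = {}" for e
      by (auto simp: elig_on_def inelig_on_def)
    then show ?thesis
      by (simp add: x lane_flow_def vec_eq_iff sum.union_disjoint same inel)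
  qed
  have "dbcp_equilibrium M \<tau> \<alpha> y'"
  proof (rule dbcp_equilibriumI[OF path y'a])
    fix e t g assume G: "g \<in> groups_on M e"
    assume "dbcp_cost M \<tau> \<alpha> y' e Express t g < dbcp_cost M \<tau> \<alpha> y' e General t g"
    then show "y' $ e $ Express $ t $ g = edge_flow y' e t g"
      using G z0(2)[of g e t] facts(1)[where e = e and t = t and g = g] unfolding dbcp_cost_less_iff x' \<alpha>p
      by (auto simp: y'_def z_def edge_flow_relane \<delta>_def elig_on_def inelig_on_def split: if_splits)
  next
    fix e t g assume G: "g \<in> groups_on M e"
    assume "dbcp_cost M \<tau> \<alpha> y' e General t g < dbcp_cost M \<tau> \<alpha> y' e Express t g"
    then show "y' $ e $ Express $ t $ g = 0"
      using G z0(3)[of g e t] facts(2)[where e = e and t = t and g = g] unfolding dbcp_cost_less_iff x' \<alpha>p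
      by (auto simp: y'_def z_def \<delta>_def elig_on_def inelig_on_def split: if_splits)
  qed
  \<comment> \<open>Eligible totals and ineligible flows are unchanged, so the invariance hypothesis
    on \<open>h\<close> applies.\<close>
  moreover have "h (y', \<tau>) = h (y, \<tau>)"
    using \<tau> y'a ya by (rule inv) (simp add: same inel)
  ultimately have "(y', x, \<tau>, \<alpha>) \<in> dbcp_set M h"
    using \<tau> \<alpha> hy x' by (simp add: dbcp_set_def)
  then have le: "dbcp_inf M h lE lR lI \<le> ereal (dbcp_objective M lE lR lI y' x \<tau> \<alpha>)"
    unfolding dbcp_inf_def by (rule INF_lower2) simp
  \<comment> \<open>The price times the eligible express flow is the revenue from eligible users,
    each unit of which is worth at least \<open>lR - lE\<close> in the comparison
    \<open>DC\<close>.\<close>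
  define gain where
    "gain = (\<lambda>e t. (lR - lE) * (p e t * (\<Sum>g\<in>elig_on M e. y $ e $ Express $ t $ g)))"
  define CC where "CC = (\<lambda>e t. lE * (\<Sum>k\<in>UNIV. \<Sum>g\<in>elig_on M e.
             vot M g t * latency M e (x $ e $ k $ t) * y $ e $ k $ t $ g))"
  define DD where "DD = (\<lambda>e t. lE * (\<Sum>k\<in>UNIV. \<Sum>g\<in>elig_on M e.
             (vot M g t * latency M e (x $ e $ k $ t)
                + of_bool (k = Express) * (1 - \<alpha> $ e $ t) * \<tau> $ e $ t) * y' $ e $ k $ t $ g)
         - lR * (\<Sum>g\<in>elig_on M e. (1 - \<alpha> $ e $ t) * \<tau> $ e $ t * y' $ e $ Express $ t $ g))"
  have DC: "DD e t \<le> CC e t - gain e t" for e t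
  proof -
    have "DD e t = lE * (\<Sum>g\<in>elig_on M e.
        (vot M g t * latency M e (x $ e $ Express $ t) + p e t) * z0 e t g
        + vot M g t * latency M e (x $ e $ General $ t) * (edge_flow y e t g - z0 e t g))
        - lR * (\<Sum>g\<in>elig_on M e. p e t * z0 e t g)"
      by (simp add: DD_def sum_lane \<alpha>p el sum.distrib)
    also have "\<dots> \<le> lE * (\<Sum>g\<in>elig_on M e.
        vot M g t * latency M e (x $ e $ Express $ t) * y $ e $ Express $ t $ g
        + vot M g t * latency M e (x $ e $ General $ t)
          * (edge_flow y e t g - y $ e $ Express $ t $ g)) - gain e t"
      unfolding gain_def
      by (rule split_cost_le) (use ys z0 assms(2) tot in \<open>auto simp: \<delta>_def\<close>)
    also have "\<dots> = CC e t - gain e t"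
      by (simp add: CC_def sum_lane edge_flow_def sum.distrib)
    finally show ?thesis .
  qed
  \<comment> \<open>The ineligible terms coincide and cancel.\<close>
  have diff: "dbcp_objective M lE lR lI y' x \<tau> \<alpha> - cbcp_objective M lE lR lI y x \<tau>
      = (\<Sum>t\<in>UNIV. \<Sum>e\<in>UNIV. DD e t) - (\<Sum>t\<in>UNIV. \<Sum>e\<in>UNIV. CC e t)"
    by (simp add: dbcp_objective_def cbcp_objective_def DD_def CC_def inel
        sum.distrib sum_subtractf sum_distrib_left[symmetric] algebra_simps)
  have g0': "0 \<le> gain e t" for e t
    using assms(10) p(1) by (auto simp: gain_def intro!: mult_nonneg_nonneg sum_nonneg y0)
  \<comment> \<open>At the edge and period given by the hypothesis on minimizers the eligible
    express flow and the latency gap are positive, hence so is the price.\<close>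
  have "0 < gain e0 t0"
  proof -
    have "0 < (\<Sum>g\<in>elig_on M e0. y $ e0 $ Express $ t0 $ g)"
      using g0 y0 by (intro sum_pos2[of _ g0]) auto
    moreover have "x $ e0 $ k $ t0 \<in> {0..}" for k
      by (simp add: x lane_flow_def sum_nonneg y0)
    then have "0 < \<delta> e0 t0"
      using strict_mono_onD[OF mono _ _ g0(3), of e0] by (simp add: \<delta>_def)
    ultimately show ?thesis
      using pos[of e0 t0] assms(10) by (simp add: gain_def)
  qed
  also have "\<dots> \<le> (\<Sum>e\<in>UNIV. gain e t0)"
    by (rule member_le_sum) (auto intro: g0')
  also have "\<dots> \<le> (\<Sum>t\<in>UNIV. \<Sum>e\<in>UNIV. gain e t)"
    by (rule member_le_sum) (auto intro!: sum_nonneg g0')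
  also have "\<dots> \<le> (\<Sum>t\<in>UNIV. \<Sum>e\<in>UNIV. CC e t - DD e t)"
    using DC by (intro sum_mono) (simp add: algebra_simps)
  finally have "dbcp_objective M lE lR lI y' x \<tau> \<alpha> < cbcp_objective M lE lR lI y x \<tau>"
    using diff by (simp add: sum_subtractf)
  then show ?thesis
    using le inf by (simp add: order.strict_trans1[OF le])
qed

end
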